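(* In a connected lune-free link diagram, there is at least one triangle which is adjacent either to another triangle, or to a tetragon, or to a pentagon.
   Context: A link diagram is a regular projection of a link to the plane, with finitely many transverse double points (crossings) and over/under information at each crossing. Its underlying projection is a plane graph, 4-valent at the crossings; the diagram is connected if this projection is connected. The regions of the diagram are the connected components of the complement of the projection in the plane, including the unbounded component. The number of sides of a region is the number of edges of the projection (segments between consecutive crossings) on its boundary. A triangle, tetragon, or pentagon is a region with $3$, $4$, or $5$ sides respectively. A lune is a region with $2$ sides, and a diagram is lune-free if it has no regions with $2$ sides. Two regions are adjacent if they share an edge.
   Formalization: The diagram is also assumed to have at least one crossing and no region with exactly 1 side; otherwise the round circle, or a trefoil diagram with a kink on every edge, is connected and lune-free but has no triangle. *)

theory Defs
  imports "HOL-Analysis.Analysis"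
begin

text \<open>
  Three-space is \<^typ>\<open>complex \<times> real\<close>: the first component is the plane of projection, the second
  the height.  A link with \<open>n\<close> components is a family \<open>K i\<close>, \<open>i < n\<close>, of regular closed
  curves of class \<open>C\<^sup>1\<close>, each parametrised by the whole real line with period 1 and pairwise
  disjointly embedded.
\<close>

type_synonym curves = "nat \<Rightarrow> real \<Rightarrow> complex \<times> real"

definition params :: "nat \<Rightarrow> (nat \<times> real) set" where
  "params n = {..<n} \<times> {0..<1}"

definition is_link :: "nat \<Rightarrow> curves \<Rightarrow> bool" where
  "is_link n K \<longleftrightarrow> n \<ge> 1 \<and>
     (\<forall>i<n. (\<forall>t. K i (t + 1) = K i t) \<and> K i C1_differentiable_on UNIV \<and>
            (\<forall>t. vector_derivative (K i) (at t) \<noteq> 0)) \<and>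
     inj_on (\<lambda>(i, t). K i t) (params n)"

definition planar :: "curves \<Rightarrow> nat \<Rightarrow> real \<Rightarrow> complex" where
  "planar K i t = fst (K i t)"

definition preimages :: "nat \<Rightarrow> curves \<Rightarrow> complex \<Rightarrow> (nat \<times> real) set" where
  "preimages n K p = {(i, t) \<in> params n. planar K i t = p}"

definition projection :: "nat \<Rightarrow> curves \<Rightarrow> complex set" where
  "projection n K = (\<Union>i<n. range (planar K i))"

definition crossings :: "nat \<Rightarrow> curves \<Rightarrow> complex set" where
  "crossings n K = {p. \<exists>a \<in> preimages n K p. \<exists>b \<in> preimages n K p. a \<noteq> b}"

text \<open>
  A link diagram is a link in regular position with respect to the projection.  The over/under
  information at a crossing is carried by the heights of its two preimages in the link, which differ
  because the link is embedded.
\<close>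

definition link_diagram :: "nat \<Rightarrow> curves \<Rightarrow> bool" where
  "link_diagram n K \<longleftrightarrow> is_link n K \<and>
     (\<forall>i<n. \<forall>t. vector_derivative (planar K i) (at t) \<noteq> 0) \<and>
     finite (crossings n K) \<and>
     (\<forall>p \<in> crossings n K. card (preimages n K p) = 2) \<and>
     (\<forall>p \<in> crossings n K. \<forall>(i, s) \<in> preimages n K p. \<forall>(j, t) \<in> preimages n K p.
        (i, s) \<noteq> (j, t) \<longrightarrow>
        span {vector_derivative (planar K i) (at s), vector_derivative (planar K j) (at t)} = UNIV)"

definition connected_diagram :: "nat \<Rightarrow> curves \<Rightarrow> bool" where
  "connected_diagram n K \<longleftrightarrow> connected (projection n K)"

text \<open>
  Edges are closed segments between consecutive crossings.  A strand returning directly to the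
  crossing it started from also yields an edge (a loop); a component without crossings has no edges.
\<close>

definition edges :: "nat \<Rightarrow> curves \<Rightarrow> complex set set" where
  "edges n K = {planar K i ` {s..t} | i s t. i < n \<and> s < t \<and>
     planar K i s \<in> crossings n K \<and> planar K i t \<in> crossings n K \<and>
     (\<forall>u \<in> {s<..<t}. planar K i u \<notin> crossings n K)}"

definition regions :: "nat \<Rightarrow> curves \<Rightarrow> complex set set" where
  "regions n K = components (- projection n K)"

definition sides :: "nat \<Rightarrow> curves \<Rightarrow> complex set \<Rightarrow> complex set set" where
  "sides n K R = {e \<in> edges n K. e \<subseteq> frontier R}"

definition polygon :: "nat \<Rightarrow> curves \<Rightarrow> nat \<Rightarrow> complex set \<Rightarrow> bool" where
  "polygon n K k R \<longleftrightarrow> R \<in> regions n K \<and> card (sides n K R) = k"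

abbreviation "is_monogon n K \<equiv> polygon n K 1"
abbreviation "is_lune n K \<equiv> polygon n K 2"
abbreviation "is_triangle n K \<equiv> polygon n K 3"
abbreviation "is_tetragon n K \<equiv> polygon n K 4"
abbreviation "is_pentagon n K \<equiv> polygon n K 5"

definition lune_free :: "nat \<Rightarrow> curves \<Rightarrow> bool" where
  "lune_free n K \<longleftrightarrow> (\<nexists>R. is_lune n K R)"

definition adjacent :: "nat \<Rightarrow> curves \<Rightarrow> complex set \<Rightarrow> complex set \<Rightarrow> bool" where
  "adjacent n K R S \<longleftrightarrow> R \<noteq> S \<and> sides n K R \<inter> sides n K S \<noteq> {}"

end

theory Submission
  imports Defs
begin

text \<open>
  Let \<open>V\<close>, \<open>E\<close> and \<open>F\<close> be the numbers of crossings, edges and regions.  Two strands pass through each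
  crossing, so \<open>E = 2 V\<close>, and Euler's formula bounds the number of regions from below by
  \<open>F \<ge> E - V + 2 = V + 2\<close>.  On the other hand, distribute the amount 4 of each region evenly over its
  sides.  Every edge is a side of at most two regions.  If no triangle had a neighbour with
  three, four or five sides, then an edge would receive at most \<open>4/3 + 4/6\<close> when a triangle is
  involved and at most \<open>4/4 + 4/4\<close> otherwise, that is, at most 2.  Summing over the edges gives
  \<open>4 F \<le> 2 E = 4 V\<close>, a contradiction.  An edge with the same region on both sides fits in as well: it
  receives at most \<open>4/3\<close>.

  The work lies in the topology behind these counts.  Euler's inequality (\<open>euler_inequality\<close>) is proved
  by growing the graph edge by edge and showing with the Jordan curve theorem that an edge with both
  ends on the part already built splits a region (\<open>crosscut_splits_component\<close>).  The facts on sides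
  rest on the local picture at a point that is no crossing: the curve is straightened by a
  map to which invariance of domain applies (\<open>regular_curve_two_sided\<close>).  It follows that at most two
  regions reach such a point, and that a region reaching one interior point of an edge has the whole
  edge on its frontier (\<open>frontier_contains_connected_set\<close>).  Connectedness of the diagram ensures that
  the projection is the union of its edges, and hence that every region has a side
  (\<open>sides_nonempty\<close>).
\<close>

section \<open>Euler's inequality for plane graphs\<close>

text \<open>
  A lower bound on a possibly infinite number of components has to be witnessed by a finite
  subfamily, because \<^const>\<open>card\<close> is 0 on infinite sets.
\<close>

definition complement_components_ge :: "complex set \<Rightarrow> nat \<Rightarrow> bool" where
  "complement_components_ge X k \<longleftrightarrow> (\<exists>\<C>. \<C> \<subseteq> components (- X) \<and> finite \<C> \<and> k \<le> card \<C>)"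

lemma component_refines:
  fixes X Y :: "'a::topological_space set"
  assumes "X \<subseteq> Y" "C \<in> components (- Y)"
  shows "\<exists>!D. D \<in> components (- X) \<and> C \<subseteq> D"
proof -
  have "C \<subseteq> - X" "C \<noteq> {}" "connected C"
    using assms in_components_subset[OF assms(2)] in_components_nonempty[OF assms(2)]
      in_components_connected[OF assms(2)] by auto
  then obtain D where D: "D \<in> components (- X)" "C \<subseteq> D"
    using exists_component_superset[of C "- X"] by auto
  moreover have "D' = D" if "D' \<in> components (- X)" "C \<subseteq> D'" for D'
    using components_eq[OF that(1) D(1)] that D \<open>C \<noteq> {}\<close> by auto
  ultimately show ?thesis by (intro ex1I[of _ D]) blast+
qed

text \<open>
  Sending a component of the smaller complement to the component of \<open>- X\<close> around it is a surjection,
  since an open component is not swallowed by a set without interior points.  Hence enlarging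
  \<open>X\<close> loses no components, and it gains one as soon as the surjection fails to be injective.
\<close>

lemma complement_components_ge_extend:
  fixes X A :: "complex set"
  assumes X: "closed X" and A: "interior A = {}" and ge: "complement_components_ge X k"
  shows "complement_components_ge (X \<union> A) k"
    and "\<lbrakk>R \<in> components (- X); C \<in> components (- (X \<union> A)); D \<in> components (- (X \<union> A));
          C \<noteq> D; C \<subseteq> R; D \<subseteq> R\<rbrakk> \<Longrightarrow> complement_components_ge (X \<union> A) (Suc k)"
proof -
  obtain \<C> where \<C>: "\<C> \<subseteq> components (- X)" "finite \<C>" "k \<le> card \<C>"
    using ge by (auto simp: complement_components_ge_def)
  define \<phi> where "\<phi> C = (THE D. D \<in> components (- X) \<and> C \<subseteq> D)" for C
  have \<phi>: "\<phi> C = D" if "C \<in> components (- (X \<union> A))" "D \<in> components (- X)" "C \<subseteq> D" for C D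
    unfolding \<phi>_def using component_refines[of X "X \<union> A" C] that by (intro the_equality) auto
  have onto: "\<exists>C \<in> components (- (X \<union> A)). C \<subseteq> D" if D: "D \<in> components (- X)" for D
  proof -
    have "open D"
      using D X open_components by blast
    then have "\<not> D \<subseteq> A"
      using A interior_maximal[of D A] in_components_nonempty[OF D] by auto
    then obtain x where x: "x \<in> D" "x \<notin> A" by auto
    then have "x \<in> - (X \<union> A)"
      using in_components_subset[OF D] by auto
    then obtain C where C: "C \<in> components (- (X \<union> A))" "x \<in> C"
      using Union_components[of "- (X \<union> A)"] by blast
    then have "C \<subseteq> D"
      using components_maximal[OF D, of C] in_components_connected[OF C(1)]
        in_components_subset[OF C(1)] x by auto
    then show ?thesis using C by auto
  qed
  have lift: "\<exists>\<U>. \<U> \<subseteq> S \<and> finite \<U> \<and> k \<le> card \<U>"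
    if sub: "\<C> \<subseteq> \<phi> ` S" for S
  proof -
    obtain \<U> where "\<U> \<subseteq> S" "inj_on \<phi> \<U>" "\<C> = \<phi> ` \<U>"
      using sub unfolding subset_image_inj by (elim exE conjE)
    moreover from this have "finite \<U>" "card \<U> = card \<C>"
      using \<C>(2) by (simp_all add: finite_image_iff card_image)
    ultimately show ?thesis
      using \<C>(3) by (intro exI[of _ \<U>]) simp
  qed
  show "complement_components_ge (X \<union> A) k"
    unfolding complement_components_ge_def
  proof (rule lift)
    show "\<C> \<subseteq> \<phi> ` components (- (X \<union> A))"
    proof
      fix E assume "E \<in> \<C>"
      then have E: "E \<in> components (- X)" using \<C>(1) by auto
      then obtain B where B: "B \<in> components (- (X \<union> A))" "B \<subseteq> E"
        using onto by auto
      then show "E \<in> \<phi> ` components (- (X \<union> A))"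
        using \<phi>[OF B(1) E B(2)] by (metis image_eqI)
    qed
  qed
  assume R: "R \<in> components (- X)" and C: "C \<in> components (- (X \<union> A))" "C \<subseteq> R"
    and D: "D \<in> components (- (X \<union> A))" "D \<subseteq> R" and ne: "C \<noteq> D"
  have "\<C> \<subseteq> \<phi> ` (components (- (X \<union> A)) - {C})"
  proof
    fix E assume E: "E \<in> \<C>"
    show "E \<in> \<phi> ` (components (- (X \<union> A)) - {C})"
    proof (cases "E = R")
      case True
      then show ?thesis using \<phi>[OF D(1) R D(2)] D ne by auto
    next
      case False
      have E': "E \<in> components (- X)" using E \<C>(1) by auto
      then obtain B where B: "B \<in> components (- (X \<union> A))" "B \<subseteq> E"
        using onto by auto
      have "\<phi> B = E" "\<phi> C = R" using \<phi>[OF B(1) E' B(2)] \<phi>[OF C(1) R C(2)] .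
      then show ?thesis using False B by auto
    qed
  qed
  from lift[OF this] obtain \<U> where \<U>: "\<U> \<subseteq> components (- (X \<union> A)) - {C}" "finite \<U>" "k \<le> card \<U>"
    by auto
  then have "C \<notin> \<U>" by auto
  then show "complement_components_ge (X \<union> A) (Suc k)"
    unfolding complement_components_ge_def using \<U> C(1)
    by (intro exI[of _ "insert C \<U>"]) auto
qed

text \<open>
  Supplies the curve to which the Jordan curve theorem applies: a cross-cut is closed up
  by an arc running inside the path connected set.
\<close>

lemma simple_closed_curve_extending:
  fixes g :: "real \<Rightarrow> complex"
  assumes g: "simple_path g" and X: "path_connected X"
    and ends: "path_image g \<inter> X = {pathstart g, pathfinish g}"
  obtains c where "simple_path c" "pathfinish c = pathstart c" "path_image g \<subseteq> path_image c"
    "path_image c \<subseteq> X \<union> path_image g"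
proof (cases "pathfinish g = pathstart g")
  case True
  then show ?thesis using that[of g] g by auto
next
  case False
  then have "arc g" using g by (simp add: arc_simple_path)
  obtain h where h: "arc h" "path_image h \<subseteq> X" "pathstart h = pathfinish g" "pathfinish h = pathstart g"
    using X ends False unfolding path_connected_arcwise by (metis Int_iff insertI1 insert_commute)
  have "simple_path (g +++ h)"
    using \<open>arc g\<close> h ends by (intro simple_path_join_loop) auto
  then show ?thesis
    using that[of "g +++ h"] h by (auto simp: path_image_join)
qed

text \<open>
  Every point of a Jordan curve is a limit of both its inside and its outside.  Applied at a
  point of the cross-cut away from \<open>X\<close>, this gives points on the two sides that lie in one component
  of \<open>- X\<close> but are separated by the curve.
\<close>

lemma crosscut_splits_component:
  fixes g :: "real \<Rightarrow> complex"
  assumes X: "closed X" "path_connected X" and g: "simple_path g"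
    and ends: "path_image g \<inter> X = {pathstart g, pathfinish g}"
  obtains R C D where "R \<in> components (- X)"
    "C \<in> components (- (X \<union> path_image g))" "D \<in> components (- (X \<union> path_image g))"
    "C \<noteq> D" "C \<subseteq> R" "D \<subseteq> R"
proof -
  obtain c where c: "simple_path c" "pathfinish c = pathstart c" "path_image g \<subseteq> path_image c"
    "path_image c \<subseteq> X \<union> path_image g"
    using simple_closed_curve_extending[OF g X(2) ends] .
  note J = Jordan_inside_outside[OF c(1,2)]
  define A where "A = path_image g - {pathstart g, pathfinish g}"
  have A: "connected A" "A \<subseteq> - X" "A \<noteq> {}"
    using connected_simple_path_endless[OF g] ends nonempty_simple_path_endless[OF g]
    by (auto simp: A_def)
  then obtain R where R: "R \<in> components (- X)" "A \<subseteq> R"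
    using exists_component_superset[of A "- X"] by auto
  obtain a where a: "a \<in> A" using A by auto
  have "open R" using R X open_components by blast
  have splits: "\<exists>C z. C \<in> components (- (X \<union> path_image g)) \<and> C \<subseteq> R \<and> z \<in> C \<and> z \<in> S"
    if S: "frontier S = path_image c" "S \<inter> path_image c = {}" for S
  proof -
    have "a \<in> closure S" using a c S(1) by (auto simp: A_def frontier_def)
    then obtain z where z: "z \<in> R" "z \<in> S"
      using \<open>open R\<close> a R(2) open_Int_closure_eq_empty[of R S] by blast
    then have "z \<in> - (X \<union> path_image g)"
      using S c(3) in_components_subset[OF R(1)] by auto
    then obtain C where C: "C \<in> components (- (X \<union> path_image g))" "z \<in> C"
      using Union_components by blast
    then have "C \<subseteq> R"
      using components_maximal[OF R(1), of C] in_components_connected[OF C(1)]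
        in_components_subset[OF C(1)] z by auto
    then show ?thesis using C z by blast
  qed
  obtain C x where C: "C \<in> components (- (X \<union> path_image g))" "C \<subseteq> R" "x \<in> C"
      "x \<in> inside (path_image c)"
    using splits[of "inside (path_image c)"] J by auto
  obtain D y where D: "D \<in> components (- (X \<union> path_image g))" "D \<subseteq> R" "y \<in> D"
      "y \<in> outside (path_image c)"
    using splits[of "outside (path_image c)"] J by auto
  have "C \<noteq> D"
  proof
    assume "C = D"
    have "connected C" "C \<subseteq> - (X \<union> path_image g)"
      using in_components_connected[OF C(1)] in_components_subset[OF C(1)] by auto
    then have "C \<subseteq> inside (path_image c) \<union> outside (path_image c)"
      using J c(4) by auto
    then show False
      using connectedD[OF \<open>connected C\<close>, of "inside (path_image c)" "outside (path_image c)"] J C D \<open>C = D\<close>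
      by auto
  qed
  then show ?thesis using that R C D by blast
qed

text \<open>
  The half \<open>F \<ge> E - V + 2\<close> of Euler's formula for a connected plane graph.  The graph is grown from
  a single vertex by adding edges that touch the part already built.  An edge with only one end
  there brings a new vertex; an edge with both ends there is a cross-cut and brings a new face.
  Connectedness guarantees that a suitable edge is available until all of them are used.
\<close>

theorem euler_inequality:
  fixes V :: "complex set" and G :: "complex set set"
  assumes fin: "finite V" "finite G"
    and arcs: "\<And>e. e \<in> G \<Longrightarrow> \<exists>g. simple_path g \<and> path_image g = e \<and> e \<inter> V = {pathstart g, pathfinish g}"
    and thin: "\<And>e. e \<in> G \<Longrightarrow> interior e = {}"
    and disj: "\<And>e f. \<lbrakk>e \<in> G; f \<in> G; e \<noteq> f\<rbrakk> \<Longrightarrow> e \<inter> f \<subseteq> V"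
    and conn: "connected (\<Union>G)" and V: "V \<noteq> {}" "V \<subseteq> \<Union>G"
  shows "\<exists>\<C>. \<C> \<subseteq> components (- \<Union>G) \<and> finite \<C> \<and> card G + 2 \<le> card \<C> + card V"
proof -
  \<comment> \<open>The last conjunct of \<open>Inv\<close> makes the subtraction of natural numbers exact.\<close>
  define Inv where "Inv H W \<longleftrightarrow> H \<subseteq> G \<and> W \<subseteq> V \<and> W \<noteq> {} \<and> V \<inter> \<Union>H \<subseteq> W \<and>
    path_connected (W \<union> \<Union>H) \<and> complement_components_ge (W \<union> \<Union>H) (card H + 2 - card W) \<and> card W \<le> card H + 1" for H W
  have compactG: "compact e" if "e \<in> G" for e
    using arcs[OF that] compact_simple_path_image by auto
  have "\<exists>H W. Inv H W \<and> card H = k" if "k \<le> card G" for k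
    using that
  proof (induction k)
    case 0
    obtain v where v: "v \<in> V" using V by auto
    have "connected (- {v})"
      by (simp add: connected_punctured_universe)
    moreover have "- {v} \<noteq> {}" by (metis (mono_tags) Compl_UNIV_eq double_complement finite.emptyI finite.insertI infinite_UNIV_char_0)
    ultimately have "complement_components_ge {v} 1"
      unfolding complement_components_ge_def
      by (intro exI[of _ "{- {v}}"]) (auto simp: in_components_self)
    then have "Inv {} {v}" using v by (auto simp: Inv_def)
    then show ?case by (intro exI[of _ "{}"] exI[of _ "{v}"]) auto
  next
    case (Suc k)
    then obtain H W where HW: "Inv H W" "card H = k" by auto
    note I = HW(1)[unfolded Inv_def]
    define X where "X = W \<union> \<Union>H"
    have "W \<noteq> {}" "W \<subseteq> V" "H \<subseteq> G" "V \<inter> \<Union>H \<subseteq> W" "card W \<le> card H + 1"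
      using I by simp_all
    have finHW: "finite H" "finite W" using I fin by (auto intro: finite_subset)
    have compact_sub: "compact (W' \<union> \<Union>H')" if "H' \<subseteq> G" "W' \<subseteq> V" for H' W'
    proof (intro compact_Un compact_Union)
      show "compact W'" using that fin finite_subset finite_imp_compact by blast
    qed (use that fin compactG finite_subset in \<open>blast+\<close>)
    have "H \<noteq> G" using HW Suc.prems by auto
    have meets: "e \<inter> X \<subseteq> W" if "e \<in> G - H" for e
    proof
      fix x assume x: "x \<in> e \<inter> X"
      show "x \<in> W"
      proof (cases "x \<in> W")
        case False
        then obtain f where "f \<in> H" "x \<in> f" using x by (auto simp: X_def)
        moreover from this have "x \<in> V" using disj[of e f] that I x by blast
        ultimately show ?thesis using I by blast
      qed
    qed
    have "\<exists>e \<in> G - H. e \<inter> W \<noteq> {}"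
    proof (rule ccontr)
      assume none: "\<not> ?thesis"
      \<comment> \<open>The part already built and the rest would be disjoint closed sets.\<close>
      define Y where "Y = (V - W) \<union> \<Union>(G - H)"
      have "X \<inter> e = {}" if "e \<in> G - H" for e
        using meets[of e] none that by blast
      moreover have "X \<inter> (V - W) = {}" using I by (auto simp: X_def)
      ultimately have "X \<inter> Y = {}" by (auto simp: Y_def)
      then have "X \<inter> Y \<inter> \<Union>G = {}" by auto
      moreover have XY: "X \<union> Y = \<Union>G" using I V by (auto simp: X_def Y_def)
      moreover have "X \<inter> \<Union>G \<noteq> {}" using \<open>W \<noteq> {}\<close> XY by (auto simp: X_def)
      moreover have "Y \<inter> \<Union>G \<noteq> {}"
      proof -
        obtain e where e: "e \<in> G - H" using I \<open>H \<noteq> G\<close> by auto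
        then have "e \<noteq> {}" using arcs[of e] by blast
        then show ?thesis using e by (auto simp: Y_def)
      qed
      moreover have "closed X" "closed Y"
        using compact_sub[of H W] compact_sub[of "G - H" "V - W"] I
        by (auto simp: X_def Y_def compact_imp_closed)
      ultimately show False
        using connected_closedD[OF conn, of X Y] by auto
    qed
    then obtain e where e: "e \<in> G" "e \<notin> H" "e \<inter> W \<noteq> {}" by auto
    obtain g0 where g0: "simple_path g0" "path_image g0 = e" "e \<inter> V = {pathstart g0, pathfinish g0}"
      using arcs[OF e(1)] by blast
    have "\<exists>g. simple_path g \<and> path_image g = e \<and> e \<inter> V = {pathstart g, pathfinish g} \<and> pathstart g \<in> W"
    proof (cases "pathstart g0 \<in> W")
      case False
      obtain x where "x \<in> e" "x \<in> W" using e(3) by blast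
      moreover from this have "x \<in> {pathstart g0, pathfinish g0}"
        using \<open>W \<subseteq> V\<close> g0(3) by blast
      ultimately have "pathfinish g0 \<in> W" using False by auto
      then show ?thesis
        using g0 by (intro exI[of _ "reversepath g0"]) (simp add: simple_path_reversepath insert_commute)
    qed (use g0 in \<open>intro exI[of _ g0], simp\<close>)
    then obtain g where g: "simple_path g" "path_image g = e" "e \<inter> V = {pathstart g, pathfinish g}"
      "pathstart g \<in> W" by (elim exE conjE)
    have "path_connected e" using g simple_path_imp_path path_connected_path_image by blast
    have eX: "e \<inter> X \<subseteq> V"
      using meets[of e] e(1,2) \<open>W \<subseteq> V\<close> by blast
    have VX: "V \<inter> X = W" using \<open>W \<subseteq> V\<close> \<open>V \<inter> \<Union>H \<subseteq> W\<close> by (auto simp: X_def)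
    have "closed X" using compact_sub[of H W] I by (auto simp: X_def compact_imp_closed)
    have card: "card (insert e H) = Suc (card H)" using e finHW by auto
    have pc: "path_connected (X \<union> e)"
    proof (rule path_connected_Un)
      show "X \<inter> e \<noteq> {}" using g(2,4) pathstart_in_path_image[of g] by (auto simp: X_def)
    qed (use I \<open>path_connected e\<close> in \<open>auto simp: X_def\<close>)
    have V_insert: "V \<inter> \<Union>(insert e H) = (e \<inter> V) \<union> (V \<inter> \<Union>H)" by auto
    have geX: "complement_components_ge X (card H + 2 - card W)" using I by (simp add: X_def)
    show ?case
    proof (cases "pathfinish g \<in> W")
      case True
      have ends: "path_image g \<inter> X = {pathstart g, pathfinish g}"
        using eX VX g(2,3,4) True by blast
      obtain R C D where "R \<in> components (- X)"
        "C \<in> components (- (X \<union> e))" "D \<in> components (- (X \<union> e))" "C \<noteq> D" "C \<subseteq> R" "D \<subseteq> R"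
        using crosscut_splits_component[OF \<open>closed X\<close> _ g(1) ends] I g(2) by (auto simp: X_def)
      then have "complement_components_ge (X \<union> e) (Suc (card H + 2 - card W))"
        using complement_components_ge_extend(2)[OF \<open>closed X\<close> thin[OF e(1)] geX] by blast
      moreover have "Suc (card H + 2 - card W) = card (insert e H) + 2 - card W"
        unfolding card using \<open>card W \<le> card H + 1\<close> by arith
      moreover have "X \<union> e = W \<union> \<Union>(insert e H)" by (auto simp: X_def)
      moreover have "V \<inter> \<Union>(insert e H) \<subseteq> W"
        unfolding V_insert using \<open>V \<inter> \<Union>H \<subseteq> W\<close> g(3,4) True by simp
      ultimately have "Inv (insert e H) W"
        using I e pc card unfolding Inv_def by simp
      then show ?thesis using card HW by auto
    next
      case False
      let ?W = "insert (pathfinish g) W"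
      have "complement_components_ge (X \<union> e) (card H + 2 - card W)"
        using complement_components_ge_extend(1)[OF \<open>closed X\<close> thin[OF e(1)] geX] .
      moreover have "card H + 2 - card W = card (insert e H) + 2 - card ?W"
        using card False finHW by simp
      moreover have "X \<union> e = ?W \<union> \<Union>(insert e H)"
        using g(2) pathfinish_in_path_image[of g] by (auto simp: X_def)
      moreover have "V \<inter> \<Union>(insert e H) \<subseteq> ?W"
        unfolding V_insert using \<open>V \<inter> \<Union>H \<subseteq> W\<close> g(3,4) by auto
      moreover have "pathfinish g \<in> V" using g(3) by auto
      ultimately have "Inv (insert e H) ?W"
        using I e pc card False finHW unfolding Inv_def by simp
      then show ?thesis using card HW by auto
    qed
  qed
  then obtain H W where HW: "Inv H W" "card H = card G" by blast
  note I = HW(1)[unfolded Inv_def]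
  have "H = G" using HW I fin by (metis card_subset_eq)
  then have "W = V" using I V(2) by (simp add: inf.absorb1 subset_antisym)
  have "V \<union> \<Union>G = \<Union>G" using V(2) by (rule Un_absorb1)
  then have "complement_components_ge (\<Union>G) (card G + 2 - card V)"
    using I \<open>H = G\<close> \<open>W = V\<close> by simp
  then obtain \<C> where "\<C> \<subseteq> components (- \<Union>G)" "finite \<C>" "card G + 2 - card V \<le> card \<C>"
    unfolding complement_components_ge_def by (elim exE conjE)
  then show ?thesis by (intro exI[of _ \<C>]) simp
qed

section \<open>The two sides of a regular curve\<close>

text \<open>
  The sets \<open>P\<close> and \<open>Q\<close> are the two local sides of \<open>X\<close> at \<open>a\<close>.  Asking only that they be connected,
  and not that they be components of a complement, leaves room for bridges: both may lie in the
  same component of the complement.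
\<close>

definition two_sided :: "complex set \<Rightarrow> complex \<Rightarrow> bool" where
  "two_sided X a \<longleftrightarrow> (\<exists>U P Q. open U \<and> a \<in> U \<and> connected P \<and> connected Q \<and>
     P \<inter> X = {} \<and> Q \<inter> X = {} \<and> U \<subseteq> X \<union> P \<union> Q \<and> U \<inter> X \<subseteq> closure P \<inter> closure Q)"

text \<open>
  The map \<open>\<Phi> (x + \<i> y) = \<gamma> x + \<i> d y\<close>, where \<open>d\<close> is the velocity at \<open>t0\<close>, straightens the curve.
  The coordinate of \<open>\<gamma>\<close> along \<open>d\<close> is strictly increasing near \<open>t0\<close>, so \<open>\<Phi>\<close> is injective
  on a vertical strip, and by invariance of domain it maps a small disc onto a neighbourhood of
  \<open>\<gamma> t0\<close>.  The upper and lower half discs give the two sides.  The hypothesis \<open>loc\<close> says that the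
  rest of \<open>X\<close> stays away from \<open>\<gamma> t0\<close>.
\<close>

lemma regular_curve_two_sided:
  fixes \<gamma> D :: "real \<Rightarrow> complex"
  assumes der: "\<And>t. (\<gamma> has_vector_derivative D t) (at t)" and contD: "isCont D t0" and nz: "D t0 \<noteq> 0"
    and range: "range \<gamma> \<subseteq> X"
    and loc: "\<And>\<delta>. 0 < \<delta> \<Longrightarrow> \<exists>Y. closed Y \<and> \<gamma> t0 \<notin> Y \<and> X \<subseteq> Y \<union> \<gamma> ` {t0 - \<delta><..<t0 + \<delta>}"
  shows "two_sided X (\<gamma> t0)"
proof -
  define d where "d = D t0"
  have "isCont (\<lambda>t. Re (D t / d)) t0"
    using contD nz by (auto simp: d_def intro!: continuous_intros)
  moreover have at_t0: "Re (D t0 / d) = 1" using nz by (simp add: d_def)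
  ultimately have "\<forall>\<^sub>F t in at t0. 0 < Re (D t / d)"
    using order_tendstoD(1)[of _ _ "at t0" 0] by (metis isCont_def zero_less_one)
  then obtain \<delta> where "0 < \<delta>" "\<And>t. \<lbrakk>t \<noteq> t0; \<bar>t - t0\<bar> < \<delta>\<rbrakk> \<Longrightarrow> 0 < Re (D t / d)"
    by (auto simp: eventually_at dist_real_def)
  then have \<delta>: "0 < \<delta>" "\<And>t. \<bar>t - t0\<bar> < \<delta> \<Longrightarrow> 0 < Re (D t / d)"
    using at_t0 by (auto, metis zero_less_one)
  obtain Y where Y: "closed Y" "\<gamma> t0 \<notin> Y" "X \<subseteq> Y \<union> \<gamma> ` {t0 - \<delta><..<t0 + \<delta>}"
    using loc[OF \<delta>(1)] by auto
  have mono: "Re (\<gamma> s / d) < Re (\<gamma> t / d)" if "t0 - \<delta> < s" "s < t" "t < t0 + \<delta>" for s t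
  proof (rule DERIV_pos_imp_increasing[OF that(2)])
    fix x assume "s \<le> x" "x \<le> t"
    have "((\<lambda>t. \<gamma> t / d) has_vector_derivative D x / d) (at x)"
      using der[of x] by (rule has_vector_derivative_divide)
    then have "((\<lambda>t. Re (\<gamma> t / d)) has_real_derivative Re (D x / d)) (at x)"
      unfolding has_real_derivative_iff_has_vector_derivative
      by (rule bounded_linear.has_vector_derivative[OF bounded_linear_Re])
    then show "\<exists>y. ((\<lambda>t. Re (\<gamma> t / d)) has_real_derivative y) (at x) \<and> 0 < y"
      using \<delta>(2)[of x] \<open>s \<le> x\<close> \<open>x \<le> t\<close> that by auto
  qed
  define \<Phi> where "\<Phi> z = \<gamma> (Re z) + \<i> * d * complex_of_real (Im z)" for z
  have cont\<gamma>: "continuous_on UNIV \<gamma>"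
    using has_vector_derivative_continuous[OF der] by (auto intro: continuous_at_imp_continuous_on)
  have cont: "continuous_on A \<Phi>" for A
    unfolding \<Phi>_def
    by (intro continuous_intros continuous_on_compose2[OF cont\<gamma>]) auto
  have inj: "inj_on \<Phi> {z. \<bar>Re z - t0\<bar> < \<delta>}"
  proof (rule inj_onI)
    fix z w assume zw: "z \<in> {z. \<bar>Re z - t0\<bar> < \<delta>}" "w \<in> {z. \<bar>Re z - t0\<bar> < \<delta>}" "\<Phi> z = \<Phi> w"
    have Re: "Re (\<Phi> v / d) = Re (\<gamma> (Re v) / d)" for v
      using nz by (simp add: \<Phi>_def d_def add_divide_distrib)
    have "Re z = Re w"
      using mono[of "Re z" "Re w"] mono[of "Re w" "Re z"] zw Re[of z] Re[of w]
      by (cases "Re z" "Re w" rule: linorder_cases) (auto simp: abs_less_iff)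
    moreover from this zw(3) have "Im z = Im w"
      using nz by (simp add: \<Phi>_def d_def)
    ultimately show "z = w" by (simp add: complex_eq_iff)
  qed
  have "open (\<Phi> -` (- Y))"
    using Y(1) cont[of UNIV] by (simp add: open_vimage open_Compl)
  moreover have "complex_of_real t0 \<in> \<Phi> -` (- Y)" using Y(2) by (simp add: \<Phi>_def)
  ultimately obtain r0 where r0: "r0 > 0" "ball (complex_of_real t0) r0 \<subseteq> \<Phi> -` (- Y)"
    by (meson open_contains_ball)
  define r where "r = min r0 \<delta>"
  define S where "S = ball (complex_of_real t0) r"
  have r: "r > 0" using r0 \<delta> by (simp add: r_def)
  have S\<delta>: "\<bar>Re z - t0\<bar> < \<delta>" if "z \<in> S" for z
    using that abs_Re_le_cmod[of "complex_of_real t0 - z"]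
    by (simp add: S_def r_def dist_norm abs_minus_commute)
  have SY: "\<Phi> z \<notin> Y" if "z \<in> S" for z
    using that r0 by (auto simp: S_def r_def)
  have inX: "Im z = 0" if z: "z \<in> S" "\<Phi> z \<in> X" for z
  proof -
    have "\<Phi> z \<in> \<gamma> ` {t0 - \<delta><..<t0 + \<delta>}"
      using Y(3) z SY[OF z(1)] by blast
    then obtain t where t: "t0 - \<delta> < t" "t < t0 + \<delta>" "\<Phi> z = \<gamma> t"
      by auto
    then have "\<Phi> z = \<Phi> (complex_of_real t)" by (simp add: \<Phi>_def)
    then have "z = complex_of_real t"
      using inj_onD[OF inj, of z "complex_of_real t"] S\<delta>[OF z(1)] t by (auto simp: abs_less_iff)
    then show ?thesis by simp
  qed
  define P where "P = \<Phi> ` (S \<inter> {z. Im z > 0})"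
  define Q where "Q = \<Phi> ` (S \<inter> {z. Im z < 0})"
  have "open (\<Phi> ` S)"
  proof (rule invariance_of_domain_gen[OF _ cont])
    show "inj_on \<Phi> S" using inj S\<delta> by (auto intro: inj_on_subset)
  qed (auto simp: S_def)
  moreover have "\<gamma> t0 \<in> \<Phi> ` S"
    using r by (intro image_eqI[of _ _ "complex_of_real t0"]) (auto simp: \<Phi>_def S_def)
  moreover have "connected P" "connected Q"
    unfolding P_def Q_def S_def
    by (intro connected_continuous_image[OF cont] convex_connected convex_Int convex_ball
          convex_halfspace_Im_gt convex_halfspace_Im_lt)+
  moreover have "P \<inter> X = {}" "Q \<inter> X = {}"
    using inX by (fastforce simp: P_def Q_def)+
  moreover have "\<Phi> ` S \<subseteq> X \<union> P \<union> Q"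
  proof
    fix p assume "p \<in> \<Phi> ` S"
    then obtain z where z: "z \<in> S" "p = \<Phi> z" by auto
    show "p \<in> X \<union> P \<union> Q"
    proof (cases "Im z" "0::real" rule: linorder_cases)
      case equal
      then have "\<Phi> z = \<gamma> (Re z)" by (simp add: \<Phi>_def)
      then show ?thesis using range z by auto
    qed (use z in \<open>auto simp: P_def Q_def\<close>)
  qed
  moreover have "\<Phi> ` S \<inter> X \<subseteq> closure P \<inter> closure Q"
  proof
    fix p assume "p \<in> \<Phi> ` S \<inter> X"
    then obtain z where z: "z \<in> S" "p = \<Phi> z" "Im z = 0" using inX by auto
    have approach: "\<Phi> z \<in> closure (\<Phi> ` (S \<inter> {w. 0 < c * Im w}))" if c: "c \<noteq> 0" for c :: real
    proof -
      \<comment> \<open>Vertical approach from within the half disc on the side of the sign of \<open>c\<close>.\<close>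
      define w where "w n = z + Complex 0 (c * inverse (real (Suc n)))" for n
      have "w \<longlonglongrightarrow> z + Complex 0 (c * 0)"
        unfolding w_def by (intro tendsto_intros LIMSEQ_inverse_real_of_nat)
      then have lim: "w \<longlonglongrightarrow> z" by (simp add: Complex_eq_0[symmetric] zero_complex.code[symmetric])
      then have "\<forall>\<^sub>F n in sequentially. w n \<in> S"
        using z(1) topological_tendstoD[of w z sequentially S] by (simp add: S_def)
      then have "\<forall>\<^sub>F n in sequentially. \<Phi> (w n) \<in> \<Phi> ` (S \<inter> {w. 0 < c * Im w})"
      proof (eventually_elim)
        case (elim n)
        have "0 < c * c * inverse (real (Suc n))"
          using c by (metis inverse_positive_iff_positive mult_pos_pos not_real_square_gt_zero of_nat_0_less_iff zero_less_Suc)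
        moreover have "Im (w n) = c * inverse (real (Suc n))"
          unfolding w_def using z(3) by (simp del: of_nat_Suc)
        ultimately show ?case
          using elim by (intro imageI IntI CollectI) (simp_all only: mult.assoc)
      qed
      moreover have "(\<lambda>n. \<Phi> (w n)) \<longlonglongrightarrow> \<Phi> z"
        using continuous_on_tendsto_compose[OF cont[of UNIV] lim] by simp
      ultimately show ?thesis
        by (intro Lim_in_closed_set[OF closed_closure _ sequentially_bot])
          (auto elim!: eventually_mono intro: subsetD[OF closure_subset])
    qed
    show "p \<in> closure P \<inter> closure Q"
      using approach[of 1] approach[of "-1"] z(2) by (simp add: P_def Q_def)
  qed
  ultimately show ?thesis
    unfolding two_sided_def by (intro exI[of _ "\<Phi> ` S"] exI[of _ P] exI[of _ Q] conjI)
qed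

text \<open>
  A component of the complement that reaches \<open>a\<close> contains one of the two sides, and each
  side accumulates at all of \<open>X\<close> near \<open>a\<close>.
\<close>

lemma two_sided_frontier_locally:
  assumes X: "closed X" and a: "two_sided X a" and R: "R \<in> components (- X)" and fr: "a \<in> frontier R"
  obtains U where "open U" "a \<in> U" "U \<inter> X \<subseteq> frontier R"
proof -
  obtain U P Q where U: "open U" "a \<in> U" "connected P" "connected Q" "P \<inter> X = {}" "Q \<inter> X = {}"
    "U \<subseteq> X \<union> P \<union> Q" "U \<inter> X \<subseteq> closure P \<inter> closure Q"
    using a unfolding two_sided_def by blast
  have "open R" "R \<subseteq> - X" using open_components R X in_components_subset by blast+
  have "R \<inter> U \<noteq> {}"
    using fr U(1,2) open_Int_closure_eq_empty[of U R] by (auto simp: frontier_def)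
  then have "R \<inter> P \<noteq> {} \<or> R \<inter> Q \<noteq> {}" using U(7) \<open>R \<subseteq> - X\<close> by blast
  then have "P \<subseteq> R \<or> Q \<subseteq> R"
    using components_maximal[OF R, of P] components_maximal[OF R, of Q] U by blast
  then have "U \<inter> X \<subseteq> closure R"
    using U(8) closure_mono[of P R] closure_mono[of Q R] by blast
  then have "U \<inter> X \<subseteq> frontier R"
    using \<open>open R\<close> \<open>R \<subseteq> - X\<close> by (auto simp: frontier_def interior_open)
  then show ?thesis using that U by blast
qed

lemma two_sided_at_most_two_components:
  assumes X: "closed X" and a: "two_sided X a"
  obtains R1 R2 where "{R \<in> components (- X). a \<in> frontier R} \<subseteq> {R1, R2}"
proof -
  obtain U P Q where U: "open U" "a \<in> U" "connected P" "connected Q" "P \<inter> X = {}" "Q \<inter> X = {}"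
    "U \<subseteq> X \<union> P \<union> Q" "U \<inter> X \<subseteq> closure P \<inter> closure Q"
    using a unfolding two_sided_def by blast
  define side where "side T = (SOME R. R \<in> components (- X) \<and> R \<inter> T \<noteq> {})" for T
  have side: "R = side T" if "R \<in> components (- X)" "R \<inter> T \<noteq> {}" "connected T" "T \<inter> X = {}" for R T
  proof -
    have "side T \<in> components (- X) \<and> side T \<inter> T \<noteq> {}"
      unfolding side_def by (rule someI[of _ R]) (use that in auto)
    then show ?thesis using joinable_components_eq[of T "- X" R "side T"] that by auto
  qed
  have "R = side P \<or> R = side Q" if R: "R \<in> components (- X)" "a \<in> frontier R" for R
  proof -
    have "R \<inter> U \<noteq> {}"
      using R U(1,2) open_Int_closure_eq_empty[of U R] by (auto simp: frontier_def)
    then have "R \<inter> P \<noteq> {} \<or> R \<inter> Q \<noteq> {}" using U(7) in_components_subset[OF R(1)] by blast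
    then show ?thesis using side R U by blast
  qed
  then show ?thesis using that by blast
qed

lemma two_sided_not_interior:
  assumes "two_sided X a"
  shows "a \<notin> interior X"
proof
  assume a: "a \<in> interior X"
  obtain U P where U: "open U" "a \<in> U" "P \<inter> X = {}" "U \<inter> X \<subseteq> closure P"
    using assms unfolding two_sided_def by blast
  then have "a \<in> closure P" using a interior_subset by blast
  then have "interior X \<inter> P \<noteq> {}"
    using a open_Int_closure_eq_empty[OF open_interior, of X P] by blast
  then show False using U interior_subset by blast
qed

text \<open>
  The points of \<open>E\<close> on the frontier form a set that is closed in \<open>E\<close>, and open in \<open>E\<close> by the
  preceding lemmas; so a region that touches the interior of an edge has the whole edge as a side.
\<close>

lemma frontier_contains_connected_set:
  assumes X: "closed X" and R: "R \<in> components (- X)"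
    and E: "connected E" "E \<subseteq> X" "\<And>a. a \<in> E \<Longrightarrow> two_sided X a" and meet: "E \<inter> frontier R \<noteq> {}"
  shows "closure E \<subseteq> frontier R"
proof -
  have "openin (top_of_set E) (E \<inter> frontier R)"
  proof (subst openin_subopen, intro ballI)
    fix a assume a: "a \<in> E \<inter> frontier R"
    obtain U where U: "open U" "a \<in> U" "U \<inter> X \<subseteq> frontier R"
      using two_sided_frontier_locally[OF X E(3) R] a by blast
    show "\<exists>T. openin (top_of_set E) T \<and> a \<in> T \<and> T \<subseteq> E \<inter> frontier R"
      using U a E(2) by (intro exI[of _ "E \<inter> U"]) (auto intro: openin_open_Int)
  qed
  moreover have "closedin (top_of_set E) (E \<inter> frontier R)"
    by (intro closedin_closed_Int frontier_closed)
  ultimately have "E \<inter> frontier R = E"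
    using E(1) meet unfolding connected_clopen by blast
  then show ?thesis
    by (metis closure_minimal frontier_closed inf.orderI)
qed

section \<open>Edges and regions of a link diagram\<close>

locale diagram =
  fixes n :: nat and K :: curves
  assumes link_diagram: "link_diagram n K"
begin

abbreviation \<gamma> :: "nat \<Rightarrow> real \<Rightarrow> complex" where "\<gamma> \<equiv> planar K"
abbreviation V :: "complex set" where "V \<equiv> crossings n K"
abbreviation X :: "complex set" where "X \<equiv> projection n K"
abbreviation D :: "nat \<Rightarrow> real \<Rightarrow> complex" where "D i t \<equiv> vector_derivative (\<gamma> i) (at t)"

lemma finite_V: "finite V"
  using link_diagram by (simp add: link_diagram_def)

lemma \<gamma>_derivative:
  assumes "i < n"
  shows "(\<gamma> i has_vector_derivative D i t) (at t)" and "isCont (D i) t" and "D i t \<noteq> 0"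
proof -
  have "K i C1_differentiable_on UNIV"
    using link_diagram assms by (auto simp: link_diagram_def is_link_def)
  then obtain E where E: "\<And>t. (K i has_vector_derivative E t) (at t)" "continuous_on UNIV E"
    unfolding C1_differentiable_on_def by blast
  have der: "(\<gamma> i has_vector_derivative fst (E t)) (at t)" for t
    using bounded_linear.has_vector_derivative[OF bounded_linear_fst E(1)]
    unfolding planar_def[abs_def] .
  then have "D i = (\<lambda>t. fst (E t))"
    by (auto simp: vector_derivative_at)
  moreover have "isCont (\<lambda>t. fst (E t)) t"
    using E(2) by (auto simp: continuous_on_eq_continuous_at intro!: continuous_intros)
  ultimately show "isCont (D i) t" by simp
  show "(\<gamma> i has_vector_derivative D i t) (at t)"
    using der[of t] vector_derivative_at[OF der[of t]] by simp
  show "D i t \<noteq> 0"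
    using link_diagram assms by (auto simp: link_diagram_def)
qed

lemma continuous_\<gamma>: "i < n \<Longrightarrow> continuous_on S (\<gamma> i)"
  using has_vector_derivative_continuous[OF \<gamma>_derivative(1)]
  by (auto intro: continuous_at_imp_continuous_on)

lemma compact_\<gamma>: "i < n \<Longrightarrow> compact (\<gamma> i ` {a..b})"
  by (intro compact_continuous_image continuous_\<gamma>) auto

lemma \<gamma>_int_periodic:
  assumes "i < n"
  shows "\<gamma> i (t + of_int m) = \<gamma> i t"
proof -
  have 1: "\<gamma> i (t + 1) = \<gamma> i t" for t
    using link_diagram assms by (simp add: link_diagram_def is_link_def planar_def)
  have nat: "\<gamma> i (t + of_nat k) = \<gamma> i t" for t k
  proof (induction k)
    case (Suc k)
    then show ?case using 1[of "t + of_nat k"] by (simp add: add_ac)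
  qed simp
  show ?thesis
  proof (cases m)
    case (nonneg k)
    then show ?thesis using nat by simp
  next
    case (neg k)
    then show ?thesis using nat[of "t + of_int m" "Suc k"] by simp
  qed
qed

lemma \<gamma>_frac: "i < n \<Longrightarrow> \<gamma> i (frac t) = \<gamma> i t"
  using \<gamma>_int_periodic[of i "frac t" "\<lfloor>t\<rfloor>"] by (simp add: frac_def)

lemma range_\<gamma>: "i < n \<Longrightarrow> range (\<gamma> i) = \<gamma> i ` {0..1}"
proof
  assume "i < n"
  then show "range (\<gamma> i) \<subseteq> \<gamma> i ` {0..1}"
    using \<gamma>_frac[of i] frac_lt_1 frac_ge_0
    by (metis (no_types, lifting) atLeastAtMost_iff image_eqI image_subsetI less_eq_real_def)
qed auto

lemma \<gamma>_in_X: "i < n \<Longrightarrow> \<gamma> i t \<in> X"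
  by (auto simp: projection_def)

lemma compact_X: "compact X"
  unfolding projection_def using range_\<gamma> compact_\<gamma> by (auto intro!: compact_UN)

lemma closed_X: "closed X"
  using compact_X compact_imp_closed by blast

lemma V_subset_X: "V \<subseteq> X"
  using \<gamma>_in_X by (force simp: crossings_def preimages_def params_def)

text \<open>
  Parameters that are distinct modulo the period and have the same image meet in a crossing.
\<close>

lemma parameter_unique:
  assumes "i < n" "j < n" "\<gamma> i u = \<gamma> j w" "\<gamma> i u \<notin> V"
  obtains m :: int where "i = j" "u = w + of_int m"
proof -
  have "(i, frac u) \<in> preimages n K (\<gamma> i u)" "(j, frac w) \<in> preimages n K (\<gamma> i u)"
    using assms \<gamma>_frac by (auto simp: preimages_def params_def frac_lt_1)
  then have "(i, frac u) = (j, frac w)"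
    using assms(4) unfolding crossings_def by blast
  then show ?thesis
    using that[of "\<lfloor>u\<rfloor> - \<lfloor>w\<rfloor>"] by (auto simp: frac_def)
qed

text \<open>
  The rest of the projection is the image of a compact set of parameters, and misses the point by
  the uniqueness of parameters.
\<close>

lemma two_sided_X:
  assumes i: "i < n" and t: "\<gamma> i t \<notin> V"
  shows "two_sided X (\<gamma> i t)"
proof (rule regular_curve_two_sided[where D = "D i"])
  show "range (\<gamma> i) \<subseteq> X" using i by (auto simp: \<gamma>_in_X)
  fix \<delta>0 :: real assume "0 < \<delta>0"
  \<comment> \<open>With \<open>\<delta>\<close> at most half a period, the arc and its complementary arc cover exactly one period.\<close>
  define \<delta> where "\<delta> = min \<delta>0 (1/2)"
  have \<delta>: "0 < \<delta>" "\<delta> \<le> \<delta>0" "\<delta> \<le> 1/2" using \<open>0 < \<delta>0\<close> by (auto simp: \<delta>_def)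
  define Y where "Y = (\<Union>j\<in>{..<n} - {i}. \<gamma> j ` {0..1}) \<union> \<gamma> i ` {t + \<delta>..t + 1 - \<delta>}"
  have "compact Y"
    unfolding Y_def using i by (intro compact_Un compact_UN compact_\<gamma>) auto
  moreover have "\<gamma> i t \<notin> Y"
  proof
    assume "\<gamma> i t \<in> Y"
    then obtain j w where jw: "j < n" "\<gamma> i t = \<gamma> j w" "j \<noteq> i \<or> w \<in> {t + \<delta>..t + 1 - \<delta>}"
      using i unfolding Y_def by blast
    obtain m :: int where m: "i = j" "t = w + of_int m"
      using parameter_unique[OF i jw(1,2) t] .
    then have "-1 < real_of_int m" "real_of_int m < 0" using jw(3) \<delta>(1) by auto
    then have "-1 < m" "m < 0" by linarith+
    then show False by simp
  qed
  moreover have "X \<subseteq> Y \<union> \<gamma> i ` {t - \<delta>0<..<t + \<delta>0}"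
  proof
    fix p assume "p \<in> X"
    then obtain j x where jx: "j < n" "p = \<gamma> j x" by (auto simp: projection_def)
    show "p \<in> Y \<union> \<gamma> i ` {t - \<delta>0<..<t + \<delta>0}"
    proof (cases "j = i")
      case False
      then have "p \<in> \<gamma> j ` {0..1}" using range_\<gamma>[OF jx(1)] jx(2) by auto
      then show ?thesis using False jx(1) by (auto simp: Y_def)
    next
      case True
      define m where "m = \<lceil>x - t + \<delta>\<rceil> - 1"
      define y where "y = x - of_int m"
      have y: "t - \<delta> < y" "y \<le> t + 1 - \<delta>"
        unfolding y_def m_def by linarith+
      have "\<gamma> i y = p"
        using \<gamma>_int_periodic[OF i, of y m] jx True by (simp add: y_def)
      moreover have "y \<in> {t + \<delta>..t + 1 - \<delta>} \<or> y \<in> {t - \<delta>0<..<t + \<delta>0}"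
        using y \<delta> by auto
      ultimately show ?thesis by (auto simp: Y_def)
    qed
  qed
  ultimately show "\<exists>Y. closed Y \<and> \<gamma> i t \<notin> Y \<and> X \<subseteq> Y \<union> \<gamma> i ` {t - \<delta>0<..<t + \<delta>0}"
    using compact_imp_closed by blast
qed (use i \<gamma>_derivative in auto)

text \<open>
  The passages of the link through crossings.  Each crossing is passed twice and each passage starts
  one edge, which is how \<open>E = 2 V\<close> comes about.
\<close>

definition crossing_params :: "(nat \<times> real) set" where
  "crossing_params = {(i, s) \<in> params n. \<gamma> i s \<in> V}"

lemma card_crossing_params: "finite crossing_params" "card crossing_params = 2 * card V"
proof -
  have two: "card (preimages n K p) = 2" if "p \<in> V" for p
    using link_diagram that by (auto simp: link_diagram_def)
  then have fin: "finite (preimages n K p)" if "p \<in> V" for p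
    using that by (metis card.infinite zero_neq_numeral)
  have eq: "crossing_params = (\<Union>p\<in>V. preimages n K p)"
    by (auto simp: crossing_params_def preimages_def)
  show "finite crossing_params" unfolding eq using finite_V fin by auto
  have "card crossing_params = (\<Sum>p\<in>V. card (preimages n K p))"
    unfolding eq by (rule card_UN_disjoint) (use finite_V fin in \<open>auto simp: preimages_def\<close>)
  then show "card crossing_params = 2 * card V" using two by simp
qed

definition crossing_times :: "nat \<Rightarrow> real set" where
  "crossing_times i = {t. \<gamma> i t \<in> V}"

lemma crossing_times_shift: "i < n \<Longrightarrow> t + of_int m \<in> crossing_times i \<longleftrightarrow> t \<in> crossing_times i"
  by (simp add: crossing_times_def \<gamma>_int_periodic)

lemma crossing_params_iff: "(i, s) \<in> crossing_params \<longleftrightarrow> i < n \<and> 0 \<le> s \<and> s < 1 \<and> s \<in> crossing_times i"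
  by (auto simp: crossing_params_def params_def crossing_times_def)

lemma finite_crossing_times:
  assumes "i < n"
  shows "finite (crossing_times i \<inter> {a..b})"
proof (rule finite_subset)
  show "finite (\<Union>m\<in>{\<lfloor>a\<rfloor>..\<lfloor>b\<rfloor>}. (\<lambda>q. snd q + of_int m) ` crossing_params)"
    using card_crossing_params(1) by auto
  show "crossing_times i \<inter> {a..b} \<subseteq> (\<Union>m\<in>{\<lfloor>a\<rfloor>..\<lfloor>b\<rfloor>}. (\<lambda>q. snd q + of_int m) ` crossing_params)"
  proof
    fix t assume t: "t \<in> crossing_times i \<inter> {a..b}"
    have "frac t \<in> crossing_times i" using t \<gamma>_frac[OF assms] by (simp add: crossing_times_def)
    then have "(i, frac t) \<in> crossing_params"
      using assms by (simp add: crossing_params_iff frac_lt_1)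
    moreover have "t = snd (i, frac t) + of_int \<lfloor>t\<rfloor>" by (simp add: frac_def)
    moreover have "\<lfloor>t\<rfloor> \<in> {\<lfloor>a\<rfloor>..\<lfloor>b\<rfloor>}" using t by (auto intro: floor_mono)
    ultimately show "t \<in> (\<Union>m\<in>{\<lfloor>a\<rfloor>..\<lfloor>b\<rfloor>}. (\<lambda>q. snd q + of_int m) ` crossing_params)" by blast
  qed
qed

text \<open>
  A crossing recurs after one period, so the search for the next one may stop at \<open>s + 1\<close>,
  and the minimum ranges over a finite nonempty set.
\<close>

definition next_time :: "nat \<Rightarrow> real \<Rightarrow> real" where
  "next_time i s = Min (crossing_times i \<inter> {s<..s + 1})"

lemma next_time:
  assumes i: "i < n" and s: "s \<in> crossing_times i"
  shows "s < next_time i s" "next_time i s \<le> s + 1" "next_time i s \<in> crossing_times i"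
    and "\<And>t. \<lbrakk>s < t; t < next_time i s\<rbrakk> \<Longrightarrow> t \<notin> crossing_times i"
proof -
  have fin: "finite (crossing_times i \<inter> {s<..s + 1})"
    by (rule finite_subset[OF _ finite_crossing_times[OF i, of s "s + 1"]]) auto
  moreover have "s + 1 \<in> crossing_times i \<inter> {s<..s + 1}" using crossing_times_shift[OF i, of s 1] s by auto
  ultimately have "next_time i s \<in> crossing_times i \<inter> {s<..s + 1}"
    unfolding next_time_def by (intro Min_in) auto
  then show *: "s < next_time i s" "next_time i s \<le> s + 1" "next_time i s \<in> crossing_times i" by auto
  show "t \<notin> crossing_times i" if "s < t" "t < next_time i s" for t
    using Min_le[OF fin, of t] that * unfolding next_time_def by auto
qed

lemma next_time_unique:
  assumes "i < n" "s \<in> crossing_times i" "s < t" "t \<in> crossing_times i" "\<And>u. \<lbrakk>s < u; u < t\<rbrakk> \<Longrightarrow> u \<notin> crossing_times i"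
  shows "next_time i s = t"
  using next_time[OF assms(1,2)] assms(3-5) by (meson linorder_cases)

definition edge :: "nat \<Rightarrow> real \<Rightarrow> complex set" where
  "edge i s = \<gamma> i ` {s..next_time i s}"

lemma edge_in_edges: "\<lbrakk>i < n; s \<in> crossing_times i\<rbrakk> \<Longrightarrow> edge i s \<in> edges n K"
  unfolding edges_def edge_def using next_time[of i s]
  by (intro CollectI exI[of _ i] exI[of _ s] exI[of _ "next_time i s"]) (auto simp: crossing_times_def)

lemma edge_subset_X: "i < n \<Longrightarrow> edge i s \<subseteq> X"
  using \<gamma>_in_X by (auto simp: edge_def)

lemma edges_eq: "edges n K = (\<lambda>(i, s). edge i s) ` crossing_params"
proof
  show "(\<lambda>(i, s). edge i s) ` crossing_params \<subseteq> edges n K"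
    using edge_in_edges by (auto simp: crossing_params_iff)
  show "edges n K \<subseteq> (\<lambda>(i, s). edge i s) ` crossing_params"
  proof
    fix e assume "e \<in> edges n K"
    then obtain i s t where e: "e = \<gamma> i ` {s..t}" "i < n" "s < t" "s \<in> crossing_times i" "t \<in> crossing_times i"
      "\<And>u. \<lbrakk>s < u; u < t\<rbrakk> \<Longrightarrow> u \<notin> crossing_times i"
      unfolding edges_def crossing_times_def by fastforce
    define m where "m = \<lfloor>s\<rfloor>"
    define s' where "s' = s - of_int m"
    define t' where "t' = t - of_int m"
    have st: "s = s' + of_int m" "t = t' + of_int m" by (auto simp: s'_def t'_def)
    have "next_time i s' = t'"
    proof (rule next_time_unique)
      fix u assume "s' < u" "u < t'"
      then have "u + of_int m \<notin> crossing_times i" using e(6) st by auto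
      then show "u \<notin> crossing_times i" using crossing_times_shift e(2) by auto
    qed (use e(2-5) st crossing_times_shift in auto)
    moreover have ivl: "{s..t} = (\<lambda>u. u + of_int m) ` {s'..t'}"
      using st image_add_atLeastAtMost[of "of_int m" s' t'] by (simp add: add.commute)
    ultimately have "edge i s' = e"
      unfolding e(1) edge_def ivl image_image by (simp add: \<gamma>_int_periodic[OF e(2)])
    moreover have "s' \<in> crossing_times i" using crossing_times_shift[OF e(2), of s' m] e(4) st(1) by simp
    moreover have "0 \<le> s'" "s' < 1" unfolding s'_def m_def by linarith+
    then have "(i, s') \<in> crossing_params"
      using e(2) \<open>s' \<in> crossing_times i\<close> by (simp add: crossing_params_iff)
    ultimately show "e \<in> (\<lambda>(i, s). edge i s) ` crossing_params"
      by (auto intro!: image_eqI[of _ _ "(i, s')"])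
  qed
qed

text \<open>
  A common point that is no crossing has, up to a period, the same parameter on both edges.
  Two intervals between consecutive crossing times that share an interior point are equal, and
  the normalisation of the initial times to one period excludes a translate.
\<close>

lemma edges_meet_only_in_crossings:
  assumes Q: "(i, s) \<in> crossing_params" "(j, s') \<in> crossing_params"
    and u: "u \<in> {s..next_time i s}" and w: "w \<in> {s'..next_time j s'}"
    and eq: "\<gamma> i u = \<gamma> j w" "\<gamma> i u \<notin> V"
  shows "(i, s) = (j, s')"
proof -
  have i: "i < n" "s \<in> crossing_times i" and j: "j < n" "s' \<in> crossing_times j"
    using Q by (auto simp: crossing_params_iff)
  obtain m :: int where m: "i = j" "u = w + of_int m"
    using parameter_unique[OF i(1) j(1) eq] .
  have "u \<notin> crossing_times i" "w \<notin> crossing_times i" using eq m by (auto simp: crossing_times_def)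
  have iS: "s < u" "u < next_time i s" and jS: "s' < w" "w < next_time i s'"
    using u w m \<open>u \<notin> crossing_times i\<close> \<open>w \<notin> crossing_times i\<close> i j next_time(3)[OF i] next_time(3)[OF j]
    by (auto simp: order_less_le)
  have "\<not> s < s' + of_int m"
    using next_time(4)[OF i, of "s' + of_int m"] crossing_times_shift[OF i(1), of s' m] j m iS jS by auto
  moreover have "\<not> s' + of_int m < s"
    using next_time(4)[OF j, of "s - of_int m"] crossing_times_shift[OF i(1), of "s - of_int m" m] i m iS jS by auto
  ultimately have "s = s' + of_int m" by simp
  moreover from this have "real_of_int m < 1" "-1 < real_of_int m"
    using Q by (auto simp: crossing_params_iff)
  then have "m < 1" "-1 < m" by linarith+
  then have "m = 0" by simp
  ultimately show ?thesis using m by simp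
qed

lemma edge_interior:
  assumes "i < n" "s \<in> crossing_times i" "s < u" "u < next_time i s"
  shows "\<gamma> i u \<in> edge i s" "\<gamma> i u \<notin> V"
  using next_time(4)[OF assms(1,2), of u] assms(3,4) by (auto simp: edge_def crossing_times_def)

lemma midpoint_in_edge:
  assumes "i < n" "s \<in> crossing_times i"
  obtains u where "s < u" "u < next_time i s"
  using that[of "(s + next_time i s) / 2"] next_time(1)[OF assms] by (simp add: field_simps)

lemma inj_edge: "inj_on (\<lambda>(i, s). edge i s) crossing_params"
proof (rule inj_onI, clarify)
  fix i s j s' assume Q: "(i, s) \<in> crossing_params" "(j, s') \<in> crossing_params" and eq: "edge i s = edge j s'"
  have i: "i < n" "s \<in> crossing_times i" using Q by (auto simp: crossing_params_iff)
  obtain u where u: "s < u" "u < next_time i s" using midpoint_in_edge[OF i] .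
  note ui = edge_interior[OF i u]
  then obtain w where "w \<in> {s'..next_time j s'}" "\<gamma> i u = \<gamma> j w"
    unfolding eq by (auto simp: edge_def)
  then show "i = j \<and> s = s'"
    using edges_meet_only_in_crossings[OF Q, of u w] u ui by auto
qed

lemma finite_edges: "finite (edges n K)"
  unfolding edges_eq using card_crossing_params(1) by simp

lemma card_edges: "card (edges n K) = 2 * card V"
  unfolding edges_eq using card_image[OF inj_edge] card_crossing_params(2) by simp

lemma edge_cases:
  assumes "e \<in> edges n K"
  obtains i s where "(i, s) \<in> crossing_params" "i < n" "s \<in> crossing_times i" "e = edge i s"
  using assms unfolding edges_eq by (auto simp: crossing_params_iff)

lemma edges_Int: "\<lbrakk>e \<in> edges n K; f \<in> edges n K; e \<noteq> f\<rbrakk> \<Longrightarrow> e \<inter> f \<subseteq> V"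
proof
  fix p assume e: "e \<in> edges n K" and f: "f \<in> edges n K" and "e \<noteq> f" and p: "p \<in> e \<inter> f"
  obtain i s where i: "(i, s) \<in> crossing_params" "e = edge i s" using edge_cases[OF e] by metis
  obtain j s' where j: "(j, s') \<in> crossing_params" "f = edge j s'" using edge_cases[OF f] by metis
  obtain u w where "u \<in> {s..next_time i s}" "w \<in> {s'..next_time j s'}" "p = \<gamma> i u" "p = \<gamma> j w"
    using p unfolding i(2) j(2) edge_def by blast
  then show "p \<in> V"
    using edges_meet_only_in_crossings[OF i(1) j(1)] \<open>e \<noteq> f\<close> i j by fastforce
qed

text \<open>
  Equal points that are no crossings have parameters that differ by a period, while the time interval
  of an edge is at most one period long.  The path is closed when a strand returns directly to the
  crossing it started from.
\<close>

lemma edge_simple_path: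
  assumes "e \<in> edges n K"
  shows "\<exists>g. simple_path g \<and> path_image g = e \<and> e \<inter> V = {pathstart g, pathfinish g}"
proof -
  obtain i s where i: "i < n" "s \<in> crossing_times i" and e: "e = edge i s" using edge_cases[OF assms] by metis
  define t where "t = next_time i s"
  note N = next_time[OF i, folded t_def]
  define g where "g = \<gamma> i \<circ> linepath s t"
  have "path g"
    unfolding g_def by (intro path_continuous_image continuous_\<gamma> i) auto
  moreover have "loop_free g"
    unfolding loop_free_def
  proof (intro ballI impI)
    fix x y :: real assume xy: "x \<in> {0..1}" "y \<in> {0..1}" "g x = g y"
    let ?u = "linepath s t x" and ?w = "linepath s t y"
    have uw: "?u = s + x * (t - s)" "?w = s + y * (t - s)"
      by (simp_all add: linepath_def algebra_simps)
    have range: "s \<le> s + x * (t - s)" "s + x * (t - s) \<le> t" "s \<le> s + y * (t - s)" "s + y * (t - s) \<le> t"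
    proof -
      have "0 \<le> z * (t - s) \<and> z * (t - s) \<le> t - s" if "z \<in> {0..1}" for z
        using that N(1) by (auto intro!: mult_left_le_one_le)
      from this[OF xy(1)] this[OF xy(2)] show "s \<le> s + x * (t - s)" "s + x * (t - s) \<le> t"
        "s \<le> s + y * (t - s)" "s + y * (t - s) \<le> t" by linarith+
    qed
    have ends: "x = 0 \<or> x = 1" if "?u \<in> crossing_times i"
      using N(1) N(4)[of ?u] that range unfolding uw by (smt (verit) mult_cancel_right1 mult_eq_0_iff)
    have ends': "y = 0 \<or> y = 1" if "?w \<in> crossing_times i"
      using N(1) N(4)[of ?w] that range unfolding uw by (smt (verit) mult_cancel_right1 mult_eq_0_iff)
    show "x = y \<or> x = 0 \<and> y = 1 \<or> x = 1 \<and> y = 0"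
    proof (cases "\<gamma> i ?u \<in> V")
      case True
      then have "?u \<in> crossing_times i" "?w \<in> crossing_times i" using xy(3) by (auto simp: crossing_times_def g_def)
      then show ?thesis using ends ends' by auto
    next
      case False
      obtain m :: int where m: "?u = ?w + of_int m"
        using parameter_unique[OF i(1) i(1) _ False, of ?w] xy(3) by (auto simp: g_def)
      have "?u \<notin> crossing_times i" using False by (simp add: crossing_times_def)
      then have "s < ?u" "?u < t" using range i N(3) unfolding uw by (auto simp: order_less_le)
      then have "real_of_int m < 1" "-1 < real_of_int m" using m range N(2) unfolding uw by auto
      then have "m < 1" "-1 < m" by linarith+
      then have "?u = ?w" using m by simp
      then show ?thesis using N(1) unfolding uw by auto
    qed
  qed
  moreover have img: "path_image g = e"
    using N(1) by (simp add: g_def path_image_compose e edge_def t_def[symmetric] closed_segment_eq_real_ivl)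
  moreover have "e \<inter> V = {pathstart g, pathfinish g}"
  proof
    show "e \<inter> V \<subseteq> {pathstart g, pathfinish g}"
    proof
      fix p assume "p \<in> e \<inter> V"
      then obtain u where u: "s \<le> u" "u \<le> t" "p = \<gamma> i u" "u \<in> crossing_times i"
        by (auto simp: e edge_def t_def crossing_times_def)
      then have "u = s \<or> u = t" using N(4)[of u] by fastforce
      then show "p \<in> {pathstart g, pathfinish g}"
        using u by (auto simp: g_def pathstart_def pathfinish_def linepath_def)
    qed
    have "pathstart g = \<gamma> i s" "pathfinish g = \<gamma> i t"
      by (simp_all add: g_def pathstart_def pathfinish_def linepath_def)
    then show "{pathstart g, pathfinish g} \<subseteq> e \<inter> V"
      using i N(1,3) by (auto simp: e edge_def t_def crossing_times_def)
  qed
  ultimately show ?thesis unfolding simple_path_def by blast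
qed

text \<open>
  A nonempty open set contains points other than the finitely many crossings, and at such points the
  complement of the projection accumulates.
\<close>

lemma edge_interior_empty:
  assumes "e \<in> edges n K"
  shows "interior e = {}"
proof (rule ccontr)
  assume ne: "interior e \<noteq> {}"
  obtain i s where i: "i < n" and e: "e = edge i s" using edge_cases[OF assms] by metis
  have "\<not> interior e \<subseteq> V"
    using ne finite_V by (metis empty_interior_finite finite_subset interior_interior)
  then obtain p where p: "p \<in> interior e" "p \<notin> V" by blast
  then obtain u where "p = \<gamma> i u" using interior_subset e by (auto simp: edge_def)
  then have "two_sided X p" using two_sided_X i p by auto
  moreover have "p \<in> interior X"
    using p interior_mono[of e X] edge_subset_X[OF i] e by auto
  ultimately show False using two_sided_not_interior by blast
qed

lemma edge_subset_frontier:
  assumes i: "i < n" and s: "s \<in> crossing_times i" and u: "s < u" "u < next_time i s"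
    and R: "R \<in> regions n K" and fr: "\<gamma> i u \<in> frontier R"
  shows "edge i s \<in> sides n K R"
proof -
  let ?t = "next_time i s"
  have "closure (\<gamma> i ` {s<..<?t}) \<subseteq> frontier R"
  proof (rule frontier_contains_connected_set[OF closed_X])
    show "connected (\<gamma> i ` {s<..<?t})"
      by (intro connected_continuous_image continuous_\<gamma> i) auto
    show "two_sided X a" if "a \<in> \<gamma> i ` {s<..<?t}" for a
      using that edge_interior[OF i s] two_sided_X[OF i] by auto
    show "\<gamma> i ` {s<..<?t} \<inter> frontier R \<noteq> {}"
      using u fr by (metis disjoint_iff greaterThanLessThan_iff imageI)
  qed (use R \<gamma>_in_X[OF i] in \<open>auto simp: regions_def\<close>)
  moreover have "edge i s \<subseteq> closure (\<gamma> i ` {s<..<?t})"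
    using image_closure_subset[OF continuous_\<gamma>[OF i] closed_closure closure_subset, of "{s<..<?t}"]
      next_time(1)[OF i s] by (simp add: edge_def closure_greaterThanLessThan)
  ultimately show ?thesis
    using edge_in_edges[OF i s] by (auto simp: sides_def)
qed

lemma at_most_two_regions_at_edge:
  assumes "e \<in> edges n K"
  obtains R1 R2 where "{R \<in> regions n K. e \<in> sides n K R} \<subseteq> {R1, R2}"
proof -
  obtain i s where i: "i < n" "s \<in> crossing_times i" and e: "e = edge i s" using edge_cases[OF assms] by metis
  obtain u where u: "s < u" "u < next_time i s" using midpoint_in_edge[OF i] .
  note ui = edge_interior[OF i u]
  obtain R1 R2 where "{R \<in> components (- X). \<gamma> i u \<in> frontier R} \<subseteq> {R1, R2}"
    using two_sided_at_most_two_components[OF closed_X two_sided_X[OF i(1) ui(2)]] .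
  then show ?thesis using that[of R1 R2] ui(1) e by (auto simp: regions_def sides_def)
qed

end

section \<open>Connected diagrams\<close>

locale connected_diagram_with_crossing = diagram +
  assumes connected_X: "connected X" and V_nonempty: "V \<noteq> {}"
begin

text \<open>
  A component without crossings would be separated from the others by disjoint closed sets.
\<close>

lemma component_has_crossing:
  assumes i: "i < n"
  shows "crossing_times i \<noteq> {}"
proof
  assume none: "crossing_times i = {}"
  let ?A = "\<gamma> i ` {0..1}" and ?B = "\<Union>j\<in>{..<n} - {i}. \<gamma> j ` {0..1}"
  have "closed ?A" "closed ?B"
    using i by (auto intro!: compact_imp_closed compact_UN compact_\<gamma>)
  moreover have "X \<subseteq> ?A \<union> ?B"
    unfolding projection_def using range_\<gamma> by auto
  moreover have "?A \<inter> ?B = {}"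
  proof (rule ccontr)
    assume "?A \<inter> ?B \<noteq> {}"
    then obtain u j w where "j < n" "j \<noteq> i" "\<gamma> i u = \<gamma> j w" by blast
    moreover have "\<gamma> i u \<notin> V" using none by (auto simp: crossing_times_def)
    ultimately show False using parameter_unique[OF i] by metis
  qed
  then have "?A \<inter> ?B \<inter> X = {}" by blast
  ultimately have "?A \<inter> X = {} \<or> ?B \<inter> X = {}"
    using connected_closedD[OF connected_X, of ?A ?B] by blast
  moreover have "\<gamma> i 0 \<in> ?A \<inter> X" using \<gamma>_in_X[OF i] by auto
  moreover have "?B \<inter> X \<noteq> {}"
  proof -
    obtain p where "p \<in> V" using V_nonempty by blast
    then obtain j w where j: "j < n" "0 \<le> w" "w < 1" "\<gamma> j w = p"
      by (auto simp: crossings_def preimages_def params_def)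
    then have "j \<noteq> i" using none \<open>p \<in> V\<close> by (auto simp: crossing_times_def)
    then have "p \<in> ?B \<inter> X" using j \<gamma>_in_X[OF j(1)] by fastforce
    then show ?thesis by blast
  qed
  ultimately show False by blast
qed

lemma point_on_edge:
  assumes i: "i < n"
  obtains s where "s \<in> crossing_times i" "s \<le> u" "u < next_time i s"
proof -
  obtain t where t: "t \<in> crossing_times i" using component_has_crossing[OF i] by blast
  define S where "S = crossing_times i \<inter> {u - 1..u}"
  have fin: "finite S" using finite_crossing_times[OF i] by (simp add: S_def)
  have "t + of_int \<lfloor>u - t\<rfloor> \<in> S"
    using t crossing_times_shift[OF i] unfolding S_def by (auto; linarith)
  then have "S \<noteq> {}" by blast
  then have M: "Max S \<in> S" using fin by (rule Max_in[rotated])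
  then have m: "Max S \<in> crossing_times i" "Max S \<le> u" "u - 1 \<le> Max S" by (auto simp: S_def)
  have "u < next_time i (Max S)"
  proof (rule ccontr)
    assume "\<not> u < next_time i (Max S)"
    then have "next_time i (Max S) \<in> S"
      using m next_time[OF i m(1)] by (auto simp: S_def)
    then show False using Max_ge[OF fin] next_time(1)[OF i m(1)] by fastforce
  qed
  then show ?thesis using that m by blast
qed

lemma X_eq_Union_edges: "X = \<Union>(edges n K)"
proof
  show "X \<subseteq> \<Union>(edges n K)"
  proof
    fix p assume "p \<in> X"
    then obtain i u where i: "i < n" and p: "p = \<gamma> i u" by (auto simp: projection_def)
    obtain s where s: "s \<in> crossing_times i" "s \<le> u" "u < next_time i s" using point_on_edge[OF i] .
    then have "p \<in> edge i s" by (auto simp: edge_def p)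
    then show "p \<in> \<Union>(edges n K)" using edge_in_edges[OF i s(1)] by blast
  qed
  show "\<Union>(edges n K) \<subseteq> X"
  proof
    fix p assume "p \<in> \<Union>(edges n K)"
    then obtain e where e: "e \<in> edges n K" "p \<in> e" by blast
    obtain i s where "i < n" "e = edge i s" using edge_cases[OF e(1)] by metis
    then show "p \<in> X" using e(2) edge_subset_X by blast
  qed
qed

text \<open>
  The plane minus the finitely many crossings is connected, so the frontier of a region contains
  a point that is no crossing.  The edge through that point is a side.
\<close>

lemma sides_nonempty:
  assumes R: "R \<in> regions n K"
  shows "sides n K R \<noteq> {}"
proof -
  have R': "R \<in> components (- X)" using R by (simp add: regions_def)
  have RX: "R \<inter> X = {}" "R \<noteq> {}" using in_components_subset[OF R'] in_components_nonempty[OF R'] by auto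
  have "\<not> frontier R \<subseteq> V"
  proof
    assume fr: "frontier R \<subseteq> V"
    have "connected (- V)"
      using connected_open_delete_finite[of "UNIV :: complex set" V] finite_V
      by (simp add: Compl_eq_Diff_UNIV connected_UNIV)
    moreover have "- V \<inter> R \<noteq> {}" using RX V_subset_X by blast
    ultimately have "- V - R = {}"
      using connected_Int_frontier[of "- V" R] fr by blast
    then have "X \<subseteq> V" using RX by blast
    moreover obtain p where "p \<in> V" using V_nonempty by blast
    then obtain i w where i: "i < n" "\<gamma> i w = p"
      by (auto simp: crossings_def preimages_def params_def)
    then have w: "w \<in> crossing_times i" using \<open>p \<in> V\<close> by (simp add: crossing_times_def)
    obtain u where u: "w < u" "u < next_time i w" using midpoint_in_edge[OF i(1) w] .
    have "\<gamma> i u \<notin> V" using edge_interior(2)[OF i(1) w u] .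
    ultimately show False using \<gamma>_in_X[OF i(1)] by blast
  qed
  then obtain p where p: "p \<in> frontier R" "p \<notin> V" by blast
  have "p \<in> X" using p frontier_of_components_closed_complement[OF closed_X R'] by blast
  then obtain i u where i: "i < n" and pu: "p = \<gamma> i u" by (auto simp: projection_def)
  obtain s where s: "s \<in> crossing_times i" "s \<le> u" "u < next_time i s" using point_on_edge[OF i] .
  moreover have "s \<noteq> u" using s p pu by (auto simp: crossing_times_def)
  ultimately have "edge i s \<in> sides n K R"
    using edge_subset_frontier[OF i s(1) _ _ R, of u] p pu by auto
  then show ?thesis by blast
qed

lemma finite_sides: "finite (sides n K R)"
  using finite_edges by (simp add: sides_def)

text \<open>
  Every region has a side, there are finitely many edges, and each of them serves at most two
  regions.
\<close>

lemma finite_regions: "finite (regions n K)"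
proof (rule finite_subset)
  show "regions n K \<subseteq> (\<Union>e\<in>edges n K. {R \<in> regions n K. e \<in> sides n K R})"
  proof
    fix R assume "R \<in> regions n K"
    moreover from this obtain e where "e \<in> sides n K R" using sides_nonempty by blast
    ultimately show "R \<in> (\<Union>e\<in>edges n K. {R \<in> regions n K. e \<in> sides n K R})"
      by (auto simp: sides_def)
  qed
  show "finite (\<Union>e\<in>edges n K. {R \<in> regions n K. e \<in> sides n K R})"
  proof (intro finite_UN_I finite_edges)
    fix e assume "e \<in> edges n K"
    then obtain R1 R2 where "{R \<in> regions n K. e \<in> sides n K R} \<subseteq> {R1, R2}"
      by (rule at_most_two_regions_at_edge)
    then show "finite {R \<in> regions n K. e \<in> sides n K R}"
      by (rule finite_subset) simp
  qed
qed

text \<open>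
  Euler's inequality with \<open>E = 2 V\<close>.
\<close>

lemma more_regions_than_crossings: "card V + 2 \<le> card (regions n K)"
proof -
  have "\<exists>\<C>. \<C> \<subseteq> components (- \<Union>(edges n K)) \<and> finite \<C> \<and> card (edges n K) + 2 \<le> card \<C> + card V"
    by (rule euler_inequality)
      (use finite_V finite_edges edge_simple_path edge_interior_empty edges_Int connected_X V_nonempty
          V_subset_X X_eq_Union_edges in auto)
  then obtain \<C> where \<C>: "\<C> \<subseteq> regions n K" "card (edges n K) + 2 \<le> card \<C> + card V"
    unfolding X_eq_Union_edges[symmetric] regions_def by auto
  have "card \<C> \<le> card (regions n K)" using \<C>(1) finite_regions card_mono by blast
  then show ?thesis using \<C>(2) card_edges by simp
qed

end

section \<open>Triangles and their neighbours\<close>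

text \<open>
  Give a region with \<open>k\<close> sides the weight 4 and let each of its sides carry the share \<open>4 / k\<close>.
  If the theorem failed, a side of a triangle would be shared at most with a region of at least six
  sides, so no edge would carry more than \<open>4 / 3 + 4 / 6 = 4 / 4 + 4 / 4 = 2\<close>.
\<close>

theorem theorem4p1:
  fixes n :: nat and K :: "nat \<Rightarrow> real \<Rightarrow> complex \<times> real"
  assumes "link_diagram n K"
    and "connected_diagram n K"
    and "lune_free n K"
    and has_crossing: "crossings n K \<noteq> {}"
    and no_monogon: "\<nexists>R. is_monogon n K R"
  shows "\<exists>T S. is_triangle n K T \<and> adjacent n K T S \<and>
           (is_triangle n K S \<or> is_tetragon n K S \<or> is_pentagon n K S)"
proof (rule ccontr)
  assume none: "\<not> ?thesis"
  interpret connected_diagram_with_crossing n K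
    by unfold_locales (use assms in \<open>auto simp: connected_diagram_def\<close>)
  let ?F = "regions n K" and ?E = "edges n K"
  define k where "k R = card (sides n K R)" for R
  have k3: "3 \<le> k R" if R: "R \<in> ?F" for R
  proof -
    have "k R \<noteq> 0" using sides_nonempty[OF R] finite_sides by (simp add: k_def)
    moreover have "k R \<noteq> 1" using no_monogon R by (auto simp: polygon_def k_def)
    moreover have "k R \<noteq> 2" using \<open>lune_free n K\<close> R by (auto simp: lune_free_def polygon_def k_def)
    ultimately show ?thesis by linarith
  qed
  have far: "6 \<le> k S" if "R \<in> ?F" "S \<in> ?F" "R \<noteq> S" "e \<in> sides n K R" "e \<in> sides n K S" "k R = 3" for R S e
  proof -
    have "is_triangle n K R" "adjacent n K R S"
      using that by (auto simp: polygon_def adjacent_def k_def)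
    then have "\<not> (is_triangle n K S \<or> is_tetragon n K S \<or> is_pentagon n K S)" using none by blast
    then show ?thesis using k3[OF that(2)] that(2) by (auto simp: polygon_def k_def)
  qed
  have share: "(\<Sum>R | R \<in> ?F \<and> e \<in> sides n K R. 4 / real (k R)) \<le> 2" if e: "e \<in> ?E" for e
  proof -
    obtain R1 R2 where R12: "{R \<in> ?F. e \<in> sides n K R} \<subseteq> {R1, R2}"
      using at_most_two_regions_at_edge[OF e] .
    have single: "4 / real (k R) \<le> 4 / 3" if "R \<in> ?F" for R
      using k3[OF that] by (simp add: field_simps)
    have pair: "4 / real (k R) + 4 / real (k S) \<le> 2"
      if RS: "R \<in> ?F" "S \<in> ?F" "R \<noteq> S" "e \<in> sides n K R" "e \<in> sides n K S" for R S
    proof -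
      have bound: "4 / real (k T) \<le> 4 / real m" if "m \<le> k T" "0 < m" for T m
        using that by (intro divide_left_mono) auto
      consider "k R = 3" | "k S = 3" | "4 \<le> k R" "4 \<le> k S"
        using k3[OF RS(1)] k3[OF RS(2)] by linarith
      then show ?thesis
      proof cases
        case 1
        then show ?thesis using far[OF RS] bound[of 6 S] by simp
      next
        case 2
        then show ?thesis using far[OF RS(2,1) RS(3)[symmetric] RS(5,4)] bound[of 6 R] by simp
      next
        case 3
        then have "4 / real (k R) \<le> 1" "4 / real (k S) \<le> 1" by (simp_all add: divide_le_eq)
        then show ?thesis by linarith
      qed
    qed
    have "A = {} \<or> A = {a} \<or> A = {b} \<or> A = {a, b}" if "A \<subseteq> {a, b}" for A and a b :: "complex set"
      using that by blast
    from this[OF R12] consider "{R \<in> ?F. e \<in> sides n K R} = {}" | R where "{R \<in> ?F. e \<in> sides n K R} = {R}"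
      | "R1 \<noteq> R2" "{R \<in> ?F. e \<in> sides n K R} = {R1, R2}"
      by (metis insert_absorb2)
    then show ?thesis
    proof cases
      case 1
      then show ?thesis by (simp only: sum.empty)
    next
      case (2 R)
      then have "R \<in> ?F" by auto
      then show ?thesis using single[of R] 2 by simp
    next
      case 3
      then have "R1 \<in> ?F" "R2 \<in> ?F" "e \<in> sides n K R1" "e \<in> sides n K R2" by auto
      then show ?thesis using pair[of R1 R2] 3 by simp
    qed
  qed
  have "4 * real (card ?F) = (\<Sum>R\<in>?F. \<Sum>e | e \<in> ?E \<and> e \<in> sides n K R. 4 / real (k R))"
  proof -
    have "(\<Sum>e | e \<in> ?E \<and> e \<in> sides n K R. 4 / real (k R)) = 4" if "R \<in> ?F" for R
    proof -
      have "{e \<in> ?E. e \<in> sides n K R} = sides n K R" by (auto simp: sides_def)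
      then show ?thesis using k3[OF that] by (simp add: k_def)
    qed
    then show ?thesis by simp
  qed
  also have "\<dots> = (\<Sum>e\<in>?E. \<Sum>R | R \<in> ?F \<and> e \<in> sides n K R. 4 / real (k R))"
    by (rule sum.swap_restrict[OF finite_regions finite_edges])
  also have "\<dots> \<le> (\<Sum>e\<in>?E. 2)" using share by (intro sum_mono)
  also have "\<dots> = 4 * real (card (crossings n K))" using card_edges by simp
  finally show False using more_regions_than_crossings by simp
qed

end
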